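(* Let $\mathbb{F}$ be a field. The right action of $L$ on the set of degree decreasing operators (identified with matrices), in which $A\in L$ takes a matrix $M$ to $A^{-1}MA$, is transitive. Moreover, the set of elements $A=(a_{n,k})\in L$ that satisfy $a_{n,0}=\delta_{n,0}$ for every $n\in\mathbb{N}$ is a subgroup of $L$, with respect to which the set of degree decreasing operators is a principal homogeneous space.
   Context: $\mathbb{N}=\{0,1,2,\dots\}$, and $\delta$ is the Kronecker delta. $L$ is the group, under matrix multiplication, of infinite lower triangular matrices $(a_{n,k})_{n,k\in\mathbb{N}}$ over $\mathbb{F}$ with non-zero diagonal entries. A degree decreasing operator is a linear operator $Q$ on $\mathbb{F}[x]$ such that the degree of $Q(p)$ is one less than the degree of $p$ for every non-constant $p$, and $Q(a)=0$ for $a\in\mathbb{F}$. Such operators are identified with matrices $M=(m_{n,k})_{n,k\in\mathbb{N}}$ via $Q(x^n)=\sum_k m_{n,k}x^k$; they correspond bijectively to strictly lower triangular matrices $M$ whose entries $m_{n,n-1}$, $n\geq1$, are all non-zero. A principal homogeneous space for a group $G$ is a set on which $G$ acts transitively with trivial stabilizers. *)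

theory Defs
  imports "HOL-Algebra.Group_Action" "HOL-Computational_Algebra.Polynomial"
begin

text \<open>The first argument is the row index.\<close>

type_synonym 'a inf_matrix = "nat \<Rightarrow> nat \<Rightarrow> 'a"

definition lower_triangular :: "'a::zero inf_matrix \<Rightarrow> bool" where
  "lower_triangular A \<longleftrightarrow> (\<forall>n k. n < k \<longrightarrow> A n k = 0)"

text \<open>The summation may stop at the row index \<open>n\<close> because this product is only used when the
  left factor is lower triangular, so that the remaining terms of the matrix product vanish.\<close>

definition lt_mult
    :: "'a::semiring_0 inf_matrix \<Rightarrow> 'a inf_matrix \<Rightarrow> 'a inf_matrix" where
  "lt_mult A B = (\<lambda>n k. \<Sum>j\<le>n. A n j * B j k)"

definition lt_group :: "'a::field inf_matrix monoid" where
  "lt_group = \<lparr>carrier = {A. lower_triangular A \<and> (\<forall>n. A n n \<noteq> 0)},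
               monoid.mult = lt_mult,
               one = (\<lambda>n k. if n = k then 1 else 0)\<rparr>"

text \<open>The clause \<open>Q p \<noteq> 0\<close> is needed because \<open>degree 0 = 0\<close> in the library: without it a linear
  polynomial could be sent to \<open>0\<close>.\<close>

definition degree_decreasing :: "('a::field poly \<Rightarrow> 'a poly) \<Rightarrow> bool" where
  "degree_decreasing Q \<longleftrightarrow>
     Vector_Spaces.linear smult smult Q \<and>
     (\<forall>p. degree p > 0 \<longrightarrow> Q p \<noteq> 0 \<and> degree (Q p) = degree p - 1) \<and>
     (\<forall>a. Q [:a:] = 0)"

text \<open>The matrix \<open>M\<close> with \<open>Q (x\<^sup>n) = (\<Sum>k. M n k x\<^sup>k)\<close>.\<close>

definition op_matrix :: "('a::field poly \<Rightarrow> 'a poly) \<Rightarrow> 'a inf_matrix" where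
  "op_matrix Q = (\<lambda>n k. coeff (Q (monom 1 n)) k)"

definition dd_matrices :: "'a::field inf_matrix set" where
  "dd_matrices = op_matrix ` {Q. degree_decreasing Q}"

definition lt_conj
    :: "'a::field inf_matrix \<Rightarrow> 'a inf_matrix \<Rightarrow> 'a inf_matrix" where
  "lt_conj A M = lt_mult (lt_mult (inv\<^bsub>lt_group\<^esub> A) M) A"

definition lt_first_column_unit :: "'a::field inf_matrix set" where
  "lt_first_column_unit =
     {A \<in> carrier lt_group. \<forall>n. A n 0 = (if n = 0 then 1 else 0)}"

text \<open>The library's \<^locale>\<open>group_action\<close> is a left action. Here \<open>\<phi> g x\<close> stands for the right
  action \<open>x \<cdot> g\<close>, so that \<^const>\<open>stabilizer\<close> applies unchanged.\<close>

locale right_action = group G for G (structure) +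
  fixes E :: "'x set" and \<phi> :: "'g \<Rightarrow> 'x \<Rightarrow> 'x"
  constrains G :: "('g, 'm) monoid_scheme"
  assumes act_closed: "\<lbrakk> g \<in> carrier G; x \<in> E \<rbrakk> \<Longrightarrow> \<phi> g x \<in> E"
    and act_one: "x \<in> E \<Longrightarrow> \<phi> \<one> x = x"
    and act_mult:
      "\<lbrakk> g \<in> carrier G; h \<in> carrier G; x \<in> E \<rbrakk> \<Longrightarrow> \<phi> (g \<otimes> h) x = \<phi> h (\<phi> g x)"

locale transitive_right_action = right_action +
  assumes nonempty: "E \<noteq> {}"
    and transitive: "\<lbrakk> x \<in> E; y \<in> E \<rbrakk> \<Longrightarrow> \<exists>g \<in> carrier G. \<phi> g x = y"

locale principal_homogeneous_space = transitive_right_action +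
  assumes trivial_stabilizer: "x \<in> E \<Longrightarrow> stabilizer G \<phi> x = {\<one>}"


text \<open>The identification of degree decreasing operators with matrices is faithful.\<close>

lemma vector_space_smult: "vector_space (smult :: 'a::field \<Rightarrow> 'a poly \<Rightarrow> 'a poly)"
  by unfold_locales (simp_all add: smult_add_right smult_add_left)

lemma linear_smult_iff:
  fixes Q :: "'a::field poly \<Rightarrow> 'a poly"
  shows "Vector_Spaces.linear smult smult Q \<longleftrightarrow>
     (\<forall>p q. Q (p + q) = Q p + Q q) \<and> (\<forall>c p. Q (smult c p) = smult c (Q p))"
  unfolding linear_iff_module_hom module_hom_iff
  using vector_space_smult[where 'a = 'a] by (simp add: module_iff_vector_space)

lemma linear_poly_expand:
  fixes Q :: "'a::field poly \<Rightarrow> 'a poly"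
  assumes "Vector_Spaces.linear smult smult Q"
  shows "Q p = (\<Sum>n\<le>degree p. smult (coeff p n) (Q (monom 1 n)))"
proof -
  have add: "Q (p + q) = Q p + Q q" and sm: "Q (smult c p) = smult c (Q p)" for c p q
    using assms by (auto simp: linear_smult_iff)
  have z: "Q 0 = 0" using sm[of 0 0] by simp
  have sum: "Q (\<Sum>i\<in>I. f i) = (\<Sum>i\<in>I. Q (f i))" for I :: "nat set" and f
    by (induction I rule: infinite_finite_induct) (auto simp: z add)
  have "Q p = Q (\<Sum>n\<le>degree p. smult (coeff p n) (monom 1 n))"
    by (simp add: smult_monom poly_as_sum_of_monoms)
  thus ?thesis by (simp add: sum sm)
qed

lemma op_matrix_bij:
  "bij_betw op_matrix {Q. degree_decreasing Q}
     {M :: 'a::field inf_matrix. (\<forall>n k. n \<le> k \<longrightarrow> M n k = 0) \<and> (\<forall>n. M (Suc n) n \<noteq> 0)}"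
  (is "bij_betw _ _ ?S")
proof (rule bij_betw_imageI)
  show "inj_on op_matrix {Q :: 'a poly \<Rightarrow> 'a poly. degree_decreasing Q}"
  proof (rule inj_onI)
    fix P Q :: "'a poly \<Rightarrow> 'a poly"
    assume P: "P \<in> {Q. degree_decreasing Q}" and Q: "Q \<in> {Q. degree_decreasing Q}"
      and eq: "op_matrix P = op_matrix Q"
    have m: "P (monom 1 n) = Q (monom 1 n)" for n
      using fun_cong[OF fun_cong[OF eq]] by (intro poly_eqI) (simp add: op_matrix_def)
    show "P = Q"
    proof
      fix p show "P p = Q p"
        using P Q linear_poly_expand[of P p] linear_poly_expand[of Q p]
        by (simp add: degree_decreasing_def m)
    qed
  qed
next
  show "op_matrix ` {Q. degree_decreasing Q} = ?S"
  proof (intro equalityI subsetI)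
    fix M :: "'a inf_matrix"
    assume "M \<in> op_matrix ` {Q. degree_decreasing Q}"
    then obtain Q where Q: "degree_decreasing Q" and M: "M = op_matrix Q" by auto
    have Q0: "Q (monom 1 0) = 0"
      using Q by (simp add: degree_decreasing_def monom_0)
    have QS: "Q (monom 1 (Suc n)) \<noteq> 0" "degree (Q (monom 1 (Suc n))) = n" for n
      using Q by (auto simp: degree_decreasing_def degree_monom_eq)
    have "M n k = 0" if "n \<le> k" for n k
      using that Q0 QS(2)
      by (cases n) (auto simp: M op_matrix_def intro!: coeff_eq_0)
    moreover have "M (Suc n) n \<noteq> 0" for n
      using QS[of n] by (metis M op_matrix_def leading_coeff_0_iff)
    ultimately show "M \<in> ?S" by auto
  next
    fix M :: "'a inf_matrix"
    assume M: "M \<in> ?S"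
    define R where "R n = (\<Sum>k<n. monom (M n k) k)" for n
    define Q :: "'a poly \<Rightarrow> 'a poly" where "Q p = (\<Sum>n\<le>degree p. smult (coeff p n) (R n))" for p
    have R: "coeff (R n) k = M n k" for n k
      using M by (auto simp: R_def coeff_sum not_less)
    have Qext: "Q p = (\<Sum>n\<le>N. smult (coeff p n) (R n))" if "degree p \<le> N" for p N
      unfolding Q_def using that
      by (intro sum.mono_neutral_left) (auto simp: coeff_eq_0)
    have lin: "Vector_Spaces.linear smult smult Q"
    proof (unfold linear_smult_iff, intro conjI allI)
      fix p q :: "'a poly"
      let ?N = "max (degree p) (degree q)"
      show "Q (p + q) = Q p + Q q"
        using Qext[of "p + q" ?N] Qext[of p ?N] Qext[of q ?N]
        by (simp add: degree_add_le_max smult_add_left sum.distrib)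
    next
      fix c :: 'a and p :: "'a poly"
      show "Q (smult c p) = smult c (Q p)"
        using Qext[of "smult c p" "degree p"] Qext[of p "degree p"]
        by (simp add: degree_smult_le module.scale_sum_right[OF vector_space_smult[unfolded module_iff_vector_space[symmetric]]])
    qed
    have cQ: "coeff (Q p) k = (\<Sum>n\<le>degree p. coeff p n * M n k)" for p k
      by (simp add: Q_def coeff_sum R)
    have Qc: "Q [:a:] = 0" for a
      using M by (intro poly_eqI) (simp add: cQ)
    have deg: "Q p \<noteq> 0 \<and> degree (Q p) = degree p - 1" if "degree p > 0" for p
    proof -
      obtain d where d: "degree p = Suc d" using \<open>degree p > 0\<close> by (cases "degree p") auto
      have "coeff (Q p) d = coeff p (Suc d) * M (Suc d) d"
        using M by (simp add: cQ d)
      moreover have "coeff p (Suc d) \<noteq> 0"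
        using d by (metis degree_0 leading_coeff_0_iff nat.distinct(1))
      ultimately have nz: "coeff (Q p) d \<noteq> 0" using M by simp
      have "coeff (Q p) k = 0" if "k > d" for k
        using M that by (auto simp: cQ d intro!: sum.neutral)
      hence "degree (Q p) \<le> d" by (intro degree_le) auto
      moreover have "d \<le> degree (Q p)" using nz by (rule le_degree)
      ultimately show ?thesis using nz d by auto
    qed
    have "degree_decreasing Q" using lin Qc deg by (simp add: degree_decreasing_def)
    moreover have "op_matrix Q = M"
    proof (intro ext)
      fix n k
      have "op_matrix Q n k = (\<Sum>j\<le>n. (if j = n then M n k else 0))"
        unfolding op_matrix_def cQ by (intro sum.cong) (auto simp: degree_monom_eq)
      thus "op_matrix Q n k = M n k" by simp
    qed
    ultimately show "M \<in> op_matrix ` {Q. degree_decreasing Q}" by blast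
  qed
qed

end

theory Submission
  imports Defs
begin

text \<open>Every degree decreasing operator has a normal form. Let \<open>D\<close> be the matrix of the backward
  shift \<open>x\<^sup>n \<mapsto> x\<^sup>n\<^sup>-\<^sup>1\<close>, \<open>1 \<mapsto> 0\<close>. For \<open>A \<in> L\<close>, the equation \<open>A\<^sup>-\<^sup>1 M A = D\<close> amounts to
  \<open>M A = A D\<close>, and since right multiplication by \<open>D\<close> moves the columns of \<open>A\<close> one place to the
  left, it says that column \<open>k + 1\<close> of \<open>A\<close> is \<open>M\<close> times column \<open>k\<close>. The columns of \<open>A\<close>
  are therefore \<open>v, M v, M\<^sup>2 v, \<dots>\<close>, where \<open>v\<close> is column \<open>0\<close>. In particular, exactly one such
  \<open>A\<close> has \<open>v = (1, 0, 0, \<dots>)\<close>, which is the condition defining the subgroup, and this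
  \<open>A\<close> does lie in \<open>L\<close> because \<open>M\<close> is strictly lower triangular with non-zero subdiagonal.

  Thus for each \<open>M\<close> there is a unique element of the subgroup that carries \<open>M\<close> to \<open>D\<close>
  (lemma \<open>ex1_conj_to_shift\<close>). For an action of any group, a point with this property makes the
  space principal homogeneous (lemma \<open>principal_homogeneous_spaceI_base_point\<close>); transitivity
  of the larger group \<open>L\<close> follows from transitivity of the subgroup.\<close>

section \<open>The group of lower triangular matrices\<close>

abbreviation one_matrix :: "'a::zero_neq_one inf_matrix" where
  "one_matrix \<equiv> (\<lambda>n k. if n = k then 1 else 0)"

lemma carrier_lt_group_iff:
  "A \<in> carrier lt_group \<longleftrightarrow> lower_triangular A \<and> (\<forall>n. A n n \<noteq> 0)"
  by (simp add: lt_group_def)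

lemma mult_lt_group [simp]: "monoid.mult lt_group = lt_mult"
  by (simp add: lt_group_def)

lemma one_lt_group: "\<one>\<^bsub>lt_group\<^esub> = one_matrix"
  by (simp add: lt_group_def)

text \<open>The sum over the columns of \<open>B\<close> stops at \<open>n\<close> in the product on the left, but at the row
  index \<open>j \<le> n\<close> of \<open>B\<close> in the product on the right. The two agree because row \<open>j\<close> of \<open>B\<close>
  vanishes beyond column \<open>j\<close>.\<close>

lemma lt_mult_assoc:
  fixes A B C :: "'a::field inf_matrix"
  assumes "lower_triangular B"
  shows "lt_mult (lt_mult A B) C = lt_mult A (lt_mult B C)"
proof (intro ext)
  fix n k
  have trunc: "(\<Sum>i\<le>n. B j i * C i k) = (\<Sum>i\<le>j. B j i * C i k)" if "j \<le> n" for j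
    using that assms by (intro sum.mono_neutral_right) (auto simp: lower_triangular_def)
  have "lt_mult (lt_mult A B) C n k = (\<Sum>i\<le>n. \<Sum>j\<le>n. A n j * (B j i * C i k))"
    by (simp add: lt_mult_def sum_distrib_right mult.assoc)
  also have "\<dots> = (\<Sum>j\<le>n. A n j * (\<Sum>i\<le>n. B j i * C i k))"
    by (subst sum.swap) (simp add: sum_distrib_left)
  also have "\<dots> = lt_mult A (lt_mult B C) n k"
    by (simp add: lt_mult_def trunc)
  finally show "lt_mult (lt_mult A B) C n k = lt_mult A (lt_mult B C) n k" .
qed

lemma lt_mult_one_left: "lt_mult one_matrix A = (A :: 'a::field inf_matrix)"
proof (intro ext)
  fix n k
  have "lt_mult one_matrix A n k = (\<Sum>j\<le>n. if n = j then A j k else 0)"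
    unfolding lt_mult_def by (intro sum.cong) auto
  then show "lt_mult one_matrix A n k = A n k" by simp
qed

lemma lt_mult_one_right:
  fixes A :: "'a::field inf_matrix"
  assumes "lower_triangular A"
  shows "lt_mult A one_matrix = A"
proof (intro ext)
  fix n k
  have "lt_mult A one_matrix n k = (\<Sum>j\<le>n. if j = k then A n j else 0)"
    unfolding lt_mult_def by (intro sum.cong) auto
  then show "lt_mult A one_matrix n k = A n k"
    using assms by (auto simp: lower_triangular_def)
qed

lemma lower_triangular_lt_mult:
  "lower_triangular A \<Longrightarrow> lower_triangular B \<Longrightarrow> lower_triangular (lt_mult A B)"
  unfolding lower_triangular_def lt_mult_def by (auto intro!: sum.neutral)

lemma lt_mult_diagonal:
  assumes "lower_triangular B"
  shows "lt_mult A B n n = A n n * B n n"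
proof -
  have "lt_mult A B n n = (\<Sum>j\<in>{n}. A n j * B j n)"
    unfolding lt_mult_def using assms
    by (intro sum.mono_neutral_right) (auto simp: lower_triangular_def)
  then show ?thesis by simp
qed

lemma lt_mult_in_carrier:
  assumes "A \<in> carrier lt_group" and "B \<in> carrier lt_group"
  shows "lt_mult A B \<in> carrier lt_group"
  using assms by (auto simp: carrier_lt_group_iff lower_triangular_lt_mult lt_mult_diagonal)

text \<open>Column \<open>k\<close> of the inverse of \<open>A\<close> by forward substitution.\<close>

fun forward_subst :: "'a::field inf_matrix \<Rightarrow> nat \<Rightarrow> nat \<Rightarrow> 'a" where
  "forward_subst A k n =
     ((if n = k then 1 else 0) - (\<Sum>j\<in>{..<n}. A n j * forward_subst A k j)) / A n n"

declare forward_subst.simps [simp del]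

lemma forward_subst_eq_0: "n < k \<Longrightarrow> forward_subst A k n = 0"
  by (induction n rule: less_induct) (subst forward_subst.simps, simp)

lemma ex_right_inverse:
  fixes A :: "'a::field inf_matrix"
  assumes A: "A \<in> carrier lt_group"
  shows "\<exists>B \<in> carrier lt_group. lt_mult A B = one_matrix"
proof
  define B where "B n k = forward_subst A k n" for n k
  have diag: "A n n \<noteq> 0" for n
    using A by (simp add: carrier_lt_group_iff)
  show prod: "lt_mult A B = one_matrix"
  proof (intro ext)
    fix n k
    have "lt_mult A B n k = (\<Sum>j<n. A n j * B j k) + A n n * B n k"
      unfolding lt_mult_def by (simp add: lessThan_Suc_atMost [symmetric])
    then show "lt_mult A B n k = one_matrix n k"
      using diag[of n] by (simp add: B_def forward_subst.simps[of A k n])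
  qed
  have B: "lower_triangular B"
    by (simp add: lower_triangular_def B_def forward_subst_eq_0)
  moreover have "A n n * B n n = 1" for n
    using lt_mult_diagonal[OF B, of A n] prod by simp
  ultimately show "B \<in> carrier lt_group"
    unfolding carrier_lt_group_iff by (metis mult_zero_right zero_neq_one)
qed

lemma group_lt_group: "group (lt_group :: 'a::field inf_matrix monoid)"
proof (rule groupI)
  fix A :: "'a inf_matrix"
  assume A: "A \<in> carrier lt_group"
  \<comment> \<open>Right inverses are two-sided: if \<open>A B = B C = 1\<close> then \<open>C = A B C = A\<close>.\<close>
  obtain B where B: "B \<in> carrier lt_group" and AB: "lt_mult A B = one_matrix"
    using ex_right_inverse[OF A] by blast
  obtain C where C: "C \<in> carrier lt_group" and BC: "lt_mult B C = one_matrix"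
    using ex_right_inverse[OF B] by blast
  have "lt_mult (lt_mult A B) C = lt_mult A (lt_mult B C)"
    using B by (simp add: lt_mult_assoc carrier_lt_group_iff)
  then have "C = A"
    using A by (simp add: AB BC lt_mult_one_left lt_mult_one_right carrier_lt_group_iff)
  then show "\<exists>B \<in> carrier lt_group. B \<otimes>\<^bsub>lt_group\<^esub> A = \<one>\<^bsub>lt_group\<^esub>"
    using B BC by (auto simp: one_lt_group)
qed (simp_all add: lt_mult_in_carrier,
    simp_all add: one_lt_group lt_mult_one_left lt_mult_assoc carrier_lt_group_iff
      lower_triangular_def)

interpretation lt_group: group lt_group
  by (rule group_lt_group)

lemma lt_inv_mult:
  assumes "A \<in> carrier lt_group"
  shows "lt_mult (inv\<^bsub>lt_group\<^esub> A) A = one_matrix" "lt_mult A (inv\<^bsub>lt_group\<^esub> A) = one_matrix"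
  using lt_group.l_inv[OF assms] lt_group.r_inv[OF assms] by (simp_all add: one_lt_group)

text \<open>The subgroup consists of the \<open>A\<close> with \<open>A e\<^sub>0 = e\<^sub>0\<close>: it is the stabilizer of a vector.\<close>

lemma subgroup_lt_first_column_unit:
  "subgroup lt_first_column_unit (lt_group :: 'a::field inf_matrix monoid)"
proof (rule subgroup.intro)
  have col: "lt_mult A B n 0 = A n 0" if "B \<in> lt_first_column_unit"
    for A B :: "'a inf_matrix" and n
  proof -
    have "lt_mult A B n 0 = (\<Sum>j\<le>n. if j = 0 then A n j else 0)"
      unfolding lt_mult_def using that
      by (intro sum.cong) (auto simp: lt_first_column_unit_def)
    then show ?thesis by simp
  qed
  fix A B :: "'a inf_matrix"
  assume A: "A \<in> lt_first_column_unit"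
  have carr: "A \<in> carrier lt_group" using A by (simp add: lt_first_column_unit_def)
  have "(inv\<^bsub>lt_group\<^esub> A) n 0 = one_matrix n 0" for n
    using col[OF A, of "inv\<^bsub>lt_group\<^esub> A" n] lt_inv_mult(1)[OF carr] by simp
  then show "inv\<^bsub>lt_group\<^esub> A \<in> lt_first_column_unit"
    using carr by (simp add: lt_first_column_unit_def)
  assume B: "B \<in> lt_first_column_unit"
  show "A \<otimes>\<^bsub>lt_group\<^esub> B \<in> lt_first_column_unit"
    using A B col[OF B, of A] by (simp add: lt_first_column_unit_def lt_mult_in_carrier)
next
  show "\<one>\<^bsub>lt_group\<^esub> \<in> (lt_first_column_unit :: 'a inf_matrix set)"
    using lt_group.one_closed by (simp add: lt_first_column_unit_def one_lt_group)
qed (auto simp: lt_first_column_unit_def)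

section \<open>The action on degree decreasing operators\<close>

lemma dd_matrices_iff:
  "(M :: 'a::field inf_matrix) \<in> dd_matrices \<longleftrightarrow>
     (\<forall>n k. n \<le> k \<longrightarrow> M n k = 0) \<and> (\<forall>n. M (Suc n) n \<noteq> 0)"
  unfolding dd_matrices_def bij_betw_imp_surj_on[OF op_matrix_bij] by simp

lemma lower_triangular_dd: "M \<in> dd_matrices \<Longrightarrow> lower_triangular M"
  by (simp add: dd_matrices_iff lower_triangular_def)

lemma dd_mult_right:
  assumes M: "M \<in> dd_matrices" and A: "A \<in> carrier lt_group"
  shows "lt_mult M A \<in> dd_matrices"
proof -
  have "lt_mult M A n k = 0" if "n \<le> k" for n k
    unfolding lt_mult_def
  proof (intro sum.neutral ballI)
    fix j assume "j \<in> {..n}"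
    then show "M n j * A j k = 0"
      using that M A
      by (cases "j = n") (auto simp: dd_matrices_iff carrier_lt_group_iff lower_triangular_def)
  qed
  moreover have "lt_mult M A (Suc n) n \<noteq> 0" for n
  proof -
    have "lt_mult M A (Suc n) n = (\<Sum>j\<in>{n}. M (Suc n) j * A j n)"
      unfolding lt_mult_def
    proof (intro sum.mono_neutral_right ballI)
      fix j assume "j \<in> {..Suc n} - {n}"
      then have "j < n \<or> j = Suc n" by auto
      then show "M (Suc n) j * A j n = 0"
        using M A by (auto simp: dd_matrices_iff carrier_lt_group_iff lower_triangular_def)
    qed auto
    then show ?thesis using M A by (simp add: dd_matrices_iff carrier_lt_group_iff)
  qed
  ultimately show ?thesis by (simp add: dd_matrices_iff)
qed

lemma dd_mult_left:
  assumes A: "A \<in> carrier lt_group" and M: "M \<in> dd_matrices"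
  shows "lt_mult A M \<in> dd_matrices"
proof -
  have "lt_mult A M n k = 0" if "n \<le> k" for n k
    unfolding lt_mult_def using that M by (intro sum.neutral) (auto simp: dd_matrices_iff)
  moreover have "lt_mult A M (Suc n) n \<noteq> 0" for n
  proof -
    have "lt_mult A M (Suc n) n = (\<Sum>j\<in>{Suc n}. A (Suc n) j * M j n)"
      unfolding lt_mult_def using M
      by (intro sum.mono_neutral_right) (auto simp: dd_matrices_iff le_Suc_eq)
    then show ?thesis using M A by (simp add: dd_matrices_iff carrier_lt_group_iff)
  qed
  ultimately show ?thesis by (simp add: dd_matrices_iff)
qed

lemma lt_conj_in_dd:
  assumes "A \<in> carrier lt_group" and "M \<in> dd_matrices"
  shows "lt_conj A M \<in> dd_matrices"
  unfolding lt_conj_def using assms by (simp add: dd_mult_left dd_mult_right)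

lemma right_action_lt_conj:
  "right_action (lt_group :: 'a::field inf_matrix monoid) dd_matrices lt_conj"
proof (intro right_action.intro right_action_axioms.intro group_lt_group)
  fix M :: "'a inf_matrix" assume M: "M \<in> dd_matrices"
  have "inv\<^bsub>lt_group\<^esub> one_matrix = (one_matrix :: 'a inf_matrix)"
    using lt_group.inv_one by (simp add: one_lt_group)
  then show "lt_conj \<one>\<^bsub>lt_group\<^esub> M = M"
    unfolding lt_conj_def one_lt_group
    by (simp add: lt_mult_one_left lt_mult_one_right lower_triangular_dd[OF M])
next
  fix A B M :: "'a inf_matrix"
  assume A: "A \<in> carrier lt_group" and B: "B \<in> carrier lt_group" and M: "M \<in> dd_matrices"
  have lt: "lower_triangular A" "lower_triangular M" "lower_triangular (inv\<^bsub>lt_group\<^esub> A)"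
    using A M lt_group.inv_closed[OF A] by (simp_all add: carrier_lt_group_iff lower_triangular_dd)
  have "inv\<^bsub>lt_group\<^esub> (lt_mult A B) = lt_mult (inv\<^bsub>lt_group\<^esub> B) (inv\<^bsub>lt_group\<^esub> A)"
    using lt_group.inv_mult_group[OF A B] by simp
  then show "lt_conj (A \<otimes>\<^bsub>lt_group\<^esub> B) M = lt_conj B (lt_conj A M)"
    by (simp add: lt_conj_def lt_mult_assoc lower_triangular_lt_mult lt)
qed (rule lt_conj_in_dd)

lemma lt_conj_eq_iff:
  fixes A M N :: "'a::field inf_matrix"
  assumes A: "A \<in> carrier lt_group" and "lower_triangular M"
  shows "lt_conj A M = N \<longleftrightarrow> lt_mult M A = lt_mult A N"
proof -
  have lt: "lower_triangular A" "lower_triangular (inv\<^bsub>lt_group\<^esub> A)"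
    using A lt_group.inv_closed[OF A] by (simp_all add: carrier_lt_group_iff)
  have conj: "lt_conj A M = lt_mult (inv\<^bsub>lt_group\<^esub> A) (lt_mult M A)"
    by (simp add: lt_conj_def lt_mult_assoc assms(2))
  show ?thesis
  proof
    assume "lt_conj A M = N"
    then have "lt_mult A N = lt_mult (lt_mult A (inv\<^bsub>lt_group\<^esub> A)) (lt_mult M A)"
      using conj lt by (simp add: lt_mult_assoc)
    then show "lt_mult M A = lt_mult A N"
      by (simp add: lt_inv_mult A lt_mult_one_left)
  next
    assume "lt_mult M A = lt_mult A N"
    then have "lt_conj A M = lt_mult (lt_mult (inv\<^bsub>lt_group\<^esub> A) A) N"
      using conj lt by (simp add: lt_mult_assoc)
    then show "lt_conj A M = N"
      by (simp add: lt_inv_mult A lt_mult_one_left)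
  qed
qed

section \<open>Reduction to the backward shift\<close>

definition shift_matrix :: "'a::field inf_matrix" where
  "shift_matrix = (\<lambda>n k. if n = Suc k then 1 else 0)"

lemma shift_matrix_dd: "shift_matrix \<in> dd_matrices"
  by (simp add: shift_matrix_def dd_matrices_iff)

lemma lt_mult_shift_matrix:
  assumes "lower_triangular A"
  shows "lt_mult A shift_matrix n k = A n (Suc k)"
proof -
  have "lt_mult A shift_matrix n k = (\<Sum>j\<le>n. if j = Suc k then A n j else 0)"
    unfolding lt_mult_def shift_matrix_def by (intro sum.cong) auto
  then show ?thesis using assms by (auto simp: lower_triangular_def)
qed

text \<open>The vector \<open>M\<^sup>k e\<^sub>0\<close>.\<close>

primrec krylov_column :: "'a::field inf_matrix \<Rightarrow> nat \<Rightarrow> nat \<Rightarrow> 'a" where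
  "krylov_column M 0 = (\<lambda>n. if n = 0 then 1 else 0)"
| "krylov_column M (Suc k) = (\<lambda>n. \<Sum>j\<le>n. M n j * krylov_column M k j)"

text \<open>A strictly lower triangular \<open>M\<close> moves the first non-zero entry of a vector down by at least
  one place, and by exactly one if the subdiagonal has no zeros. This makes the matrix with columns
  \<open>M\<^sup>k e\<^sub>0\<close> an element of the group.\<close>

lemma krylov_column_eq_0:
  assumes "M \<in> dd_matrices"
  shows "n < k \<Longrightarrow> krylov_column M k n = 0"
proof (induction k arbitrary: n)
  case (Suc k)
  have "M n j * krylov_column M k j = 0" if "j \<le> n" for j
    using that Suc assms by (cases "j = n") (auto simp: dd_matrices_iff)
  then show ?case by (simp add: sum.neutral)
qed simp

lemma krylov_column_diagonal:
  assumes M: "M \<in> dd_matrices"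
  shows "krylov_column M k k \<noteq> 0"
proof (induction k)
  case (Suc k)
  have "krylov_column M (Suc k) (Suc k) = (\<Sum>j\<in>{k}. M (Suc k) j * krylov_column M k j)"
    unfolding krylov_column.simps
  proof (intro sum.mono_neutral_right ballI)
    fix j assume "j \<in> {..Suc k} - {k}"
    then have "j < k \<or> j = Suc k" by auto
    then show "M (Suc k) j * krylov_column M k j = 0"
      using M krylov_column_eq_0[OF M] by (auto simp: dd_matrices_iff)
  qed auto
  then show ?case using Suc M by (simp add: dd_matrices_iff)
qed simp

lemma lt_conj_eq_shift_iff:
  assumes M: "M \<in> dd_matrices" and A: "A \<in> carrier lt_group"
  shows "lt_conj A M = shift_matrix \<longleftrightarrow> (\<forall>n k. A n (Suc k) = (\<Sum>j\<le>n. M n j * A j k))"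
proof -
  have "lower_triangular A" using A by (simp add: carrier_lt_group_iff)
  then have "lt_mult A shift_matrix = (\<lambda>n k. A n (Suc k))"
    by (intro ext) (rule lt_mult_shift_matrix)
  then show ?thesis
    unfolding lt_conj_eq_iff[OF A lower_triangular_dd[OF M]]
    by (auto simp: lt_mult_def fun_eq_iff)
qed

text \<open>The condition of \<open>lt_conj_eq_shift_iff\<close> is a recurrence for the columns, and membership in
  the subgroup fixes its initial value.\<close>

lemma ex1_conj_to_shift:
  fixes M :: "'a::field inf_matrix"
  assumes M: "M \<in> dd_matrices"
  shows "\<exists>!A. A \<in> lt_first_column_unit \<and> lt_conj A M = shift_matrix"
proof (rule ex1I)
  let ?A = "\<lambda>n k. krylov_column M k n"
  have "?A \<in> carrier lt_group"
    using krylov_column_eq_0[OF M] krylov_column_diagonal[OF M]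
    by (simp add: carrier_lt_group_iff lower_triangular_def)
  then show "?A \<in> lt_first_column_unit \<and> lt_conj ?A M = shift_matrix"
    by (simp add: lt_first_column_unit_def lt_conj_eq_shift_iff[OF M])
next
  fix A :: "'a inf_matrix"
  assume A: "A \<in> lt_first_column_unit \<and> lt_conj A M = shift_matrix"
  then have step: "A n (Suc k) = (\<Sum>j\<le>n. M n j * A j k)" for n k
    using lt_conj_eq_shift_iff[OF M, of A] by (simp add: lt_first_column_unit_def)
  have "A n k = krylov_column M k n" for n k
    by (induction k arbitrary: n) (use A step in \<open>simp_all add: lt_first_column_unit_def\<close>)
  then show "A = (\<lambda>n k. krylov_column M k n)" by (intro ext)
qed

section \<open>Principal homogeneous spaces\<close>

lemma (in right_action) right_action_subgroup:
  assumes "subgroup H G"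
  shows "right_action (G\<lparr>carrier := H\<rparr>) E \<phi>"
  using assms subgroup.subset[OF assms]
  by (intro right_action.intro right_action_axioms.intro)
    (auto intro: subgroup.subgroup_is_group act_closed act_one act_mult simp: is_group)

text \<open>For \<open>x\<close> and \<open>y\<close> carried to the base point \<open>b\<close> by \<open>g\<close> and \<open>h\<close>, the product \<open>g h\<^sup>-\<^sup>1\<close> carries
  \<open>x\<close> to \<open>y\<close>. If \<open>s\<close> fixes \<open>x\<close>, then \<open>s g\<close> also carries \<open>x\<close> to \<open>b\<close>, so \<open>s g = g\<close> by
  uniqueness.\<close>

lemma (in right_action) principal_homogeneous_spaceI_base_point:
  assumes b: "b \<in> E" and ex1: "\<And>x. x \<in> E \<Longrightarrow> \<exists>!g. g \<in> carrier G \<and> \<phi> g x = b"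
  shows "principal_homogeneous_space G E \<phi>"
proof unfold_locales
  show "E \<noteq> {}" using b by blast
next
  fix x y assume x: "x \<in> E" and y: "y \<in> E"
  obtain g where g: "g \<in> carrier G" "\<phi> g x = b" using ex1[OF x] by blast
  obtain h where h: "h \<in> carrier G" "\<phi> h y = b" using ex1[OF y] by blast
  have "\<phi> (inv h) b = \<phi> (h \<otimes> inv h) y"
    using act_mult[of h "inv h" y] h y by simp
  then have "\<phi> (inv h) b = y" using h y by (simp add: act_one)
  then have "\<phi> (g \<otimes> inv h) x = y" using g h x by (simp add: act_mult)
  then show "\<exists>g \<in> carrier G. \<phi> g x = y" using g h by blast
next
  fix x assume x: "x \<in> E"
  obtain g where g: "g \<in> carrier G" "\<phi> g x = b" using ex1[OF x] by blast
  have "s = \<one>" if s: "s \<in> carrier G" "\<phi> s x = x" for s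
  proof -
    have "\<phi> (s \<otimes> g) x = b" using g s x by (simp add: act_mult)
    then have "s \<otimes> g = g" using ex1[OF x] g s by blast
    then show ?thesis using g s by (simp add: r_cancel_one)
  qed
  then show "stabilizer G \<phi> x = {\<one>}"
    using x by (auto simp: stabilizer_def act_one)
qed

theorem proposition4p7:
  shows "transitive_right_action (lt_group :: 'a::field inf_matrix monoid) dd_matrices lt_conj \<and>
         subgroup lt_first_column_unit (lt_group :: 'a inf_matrix monoid) \<and>
         principal_homogeneous_space
           ((lt_group :: 'a inf_matrix monoid)\<lparr>carrier := lt_first_column_unit\<rparr>)
           dd_matrices lt_conj"
proof (intro conjI)
  let ?L = "lt_group :: 'a inf_matrix monoid"
  let ?H = "?L\<lparr>carrier := lt_first_column_unit\<rparr>"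
  show H: "subgroup lt_first_column_unit ?L"
    by (rule subgroup_lt_first_column_unit)
  have "right_action ?H dd_matrices lt_conj"
    using right_action.right_action_subgroup[OF right_action_lt_conj H] .
  then show phs: "principal_homogeneous_space ?H dd_matrices lt_conj"
    by (rule right_action.principal_homogeneous_spaceI_base_point[OF _ shift_matrix_dd])
      (simp add: ex1_conj_to_shift)
  then have trans: "transitive_right_action ?H dd_matrices lt_conj"
    by (rule principal_homogeneous_space.axioms)
  show "transitive_right_action ?L dd_matrices lt_conj"
  proof (intro transitive_right_action.intro transitive_right_action_axioms.intro
      right_action_lt_conj)
    show "dd_matrices \<noteq> ({} :: 'a inf_matrix set)" using shift_matrix_dd by blast
  next
    fix M N :: "'a inf_matrix" assume "M \<in> dd_matrices" and "N \<in> dd_matrices"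
    then show "\<exists>A \<in> carrier ?L. lt_conj A M = N"
      using transitive_right_action.transitive[OF trans] subgroup.subset[OF H] by fastforce
  qed
qed

end
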